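(* Let $a>0$ and let $u_\ell,u_r\in\Omega$. Consider the problem of maximizing $\mathfrak Q(q_*,T)$ over $q_*>0$, in the case $u_i=u_\ell$. Then for any $T>0$ we have $$\max_{q_*>0}\mathfrak Q(q_*,T)=\overline Q(u_\ell),$$ and a maximizer is $q_*=\overline Q(u_\ell)$. Moreover, the maximizer is unique if and only if $u_\ell\in\mathsf{CH}_{\ell,1}$.
   Context: Fix the sound speed $a>0$. Let $\Omega\doteq\{(\rho,q)\in\mathbb R^2:\rho>0\}$ and $\mathsf D\doteq\Omega\times\Omega$. For $u=(\rho,q)\in\Omega$ write $v\doteq q/\rho$; subscripts and decorations carry over (e.g. $u_\ell=(\rho_\ell,q_\ell)$, $v_\ell=q_\ell/\rho_\ell$). The system considered is $\partial_t\rho+\partial_xq=0$, $\partial_tq+\partial_x(q^2/\rho+a^2\rho)=0$, with eigenvalues $\lambda_1(u)=v-a$, $\lambda_2(u)=v+a$. Lax curves. For $u_o\in\Omega$, $\rho>0$ and $i\in\{1,2\}$ let $\mathcal S_i^{u_o}(\rho)=\rho\left(\frac{q_o}{\rho_o}+(-1)^ia\left(\sqrt{\rho/\rho_o}-\sqrt{\rho_o/\rho}\right)\right)$ and $\mathcal R_i^{u_o}(\rho)=\rho\left(\frac{q_o}{\rho_o}+(-1)^ia\ln(\rho/\rho_o)\right)$. The forward 1-Lax curve $\mathsf{FL}_1^{u_o}$ is the graph $q=\mathcal R_1^{u_o}(\rho)$ for $\rho\le\rho_o$, $q=\mathcal S_1^{u_o}(\rho)$ for $\rho>\rho_o$. The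 backward 2-Lax curve $\mathsf{BL}_2^{u_o}$ is the graph $q=\mathcal R_2^{u_o}(\rho)$ for $\rho\le\rho_o$, $q=\mathcal S_2^{u_o}(\rho)$ for $\rho>\rho_o$. Special states. $\bar u(u_\ell)=(\bar\rho(u_\ell),\bar q(u_\ell))$ is the element of $\mathsf{FL}_1^{u_\ell}$ with maximum $q$-coordinate; $\tilde u(u_\ell,u_r)$ is the unique element of $\mathsf{FL}_1^{u_\ell}\cap\mathsf{BL}_2^{u_r}$; for $q_o\le\bar q(u_\ell)$, $\hat u(q_o,u_\ell)$ is the intersection of $\mathsf{FL}_1^{u_\ell}$ with the line $q=q_o$ having the largest $\rho$-coordinate; for $q_o\ge0$, $\check u(q_o,u_r)$ is the intersection of $\mathsf{BL}_2^{u_r}$ with the line $q=q_o$ having the largest $\rho$-coordinate. Lax Riemann solver. $\mathcal{RS}_{\rm p}[u_\ell,u_r](\xi)$, $\xi=x/t$, is the self-similar entropy weak solution of the Riemann problem with left state $u_\ell$ and right state $u_r$. It consists of a 1-wave from $u_\ell$ to $\tilde u=\tilde u(u_\ell,u_r)$ followed by a 2-wave from $\tilde u$ to $u_r$. The 1-wave is a shock of speed $v_\ell-a\sqrt{\tilde\rho/\rho_\ell}$ if $\tilde\rho>\rho_\ell$, and a rarefaction (states on $\mathsf{FL}_1^{u_\ell}$ with $\lambda_1=\xi$) if $\tilde\rho<\rho_\ell$; the 2-wave is a shock of speed $v_r+a\sqrt{\tilde\rho/\rho_r}$ if $\tilde\rho>\rho_r$, and a rarefaction (states on $\mathsf{BL}_2^{u_r}$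 with $\lambda_2=\xi$) if $\tilde\rho<\rho_r$; a wave is absent when the corresponding states coincide. At jump points take the right-continuous representative. Maximal flow. $\overline Q(u)\doteq\bar q(u)=\frac{a\rho}{e}\exp(v/a)$ if $v\le a$, and $\overline Q(u)\doteq q$ if $v>a$. One has $\overline Q(u_\ell)\le\bar q(u_\ell)$. c-Riemann solvers. Given $Q:\mathsf D\to\mathbb R$ with $Q(u_\ell,u_r)\in[0,\overline Q(u_\ell)]$ for all $(u_\ell,u_r)\in\mathsf D$, the corresponding c-Riemann solver is $\mathcal{RS}_{\rm c}[u_\ell,u_r](\xi)=\mathcal{RS}_{\rm p}[u_\ell,\hat u(Q(u_\ell,u_r),u_\ell)](\xi)$ if $\xi<0$, and $\mathcal{RS}_{\rm c}[u_\ell,u_r](\xi)=\mathcal{RS}_{\rm p}[\check u(Q(u_\ell,u_r),u_r),u_r](\xi)$ if $\xi\ge0$. The sets depending on $q_*>0$. Let $u_*^0\doteq(e\,q_*/a,0)$. For $0<\rho<e\,q_*/a$ the curve $q=\mathcal S_1^{u_*^0}(\rho)$ meets the line $q=q_*$ in exactly two points, one supersonic ($|v|>a$), denoted $u_*^{\sup}$, and one subsonic ($|v|<a$); let $v_*^{\sup}$ be the velocity of $u_*^{\sup}$ (it does not depend on $q_*$; $v_*^{\sup}\approx1.63\,a$). Set $\mathsf{CH}_\ell^{q_*,\complement}\doteq\{u\in\Omega:\ v>v_*^{\sup},\ \mathcal S_1^{u_*^0}(\rho)\le q<q_*\}$, $\mathsf{CH}_\ell^{q_*}\doteq\Omega\setminus\mathsf{CH}_\ell^{q_*,\complement}$,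 and $\mathsf{CH}_{\ell,1}\doteq\{u\in\Omega:\ v\le v_*^{\sup}\}$ (independent of $q_*$). The solver $\mathcal{RS}_{\rm h}^{q_*}$ is the c-Riemann solver corresponding to $Q_{\rm h}^{q_*}(u_\ell)=q_*$ if $\overline Q(u_\ell)\ge q_*$; $Q_{\rm h}^{q_*}(u_\ell)=0$ if $\overline Q(u_\ell)<q_*$ and $u_\ell\in\mathsf{CH}_\ell^{q_*}$; $Q_{\rm h}^{q_*}(u_\ell)=q_\ell$ if $u_\ell\in\mathsf{CH}_\ell^{q_*,\complement}$ (in which case $\overline Q(u_\ell)<q_*$). The maximization problem. For $u_i,u_\ell,u_r\in\Omega$, let $u^{q_*}=(\rho^{q_*},q^{q_*})$ be the solution of the system with initial datum equal to $u_i$ for $x<-1$, $u_\ell$ for $-1\le x<0$, $u_r$ for $x\ge0$, constructed by applying $\mathcal{RS}_{\rm h}^{q_*}$ at $x=0$ and $\mathcal{RS}_{\rm p}$ elsewhere. In the case $u_i=u_\ell$ there is no jump at $x=-1$ and $u^{q_*}(t,x)=\mathcal{RS}_{\rm h}^{q_*}[u_\ell,u_r](x/t)$ for $t>0$. For $T>0$ the average flow is $\mathfrak Q(q_*,T)\doteq\frac1T\int_0^Tq^{q_*}(t,0)\,dt$. A maximizer is a value $q_*>0$ at which $\max_{q_*>0}\mathfrak Q(q_*,T)$ is attained. *)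

theory Defs
  imports "HOL-Analysis.Analysis"
begin

text \<open>A state is a pair (rho, q) of density and flow, \<open>a\<close> is the sound speed, and the wave
  family \<open>i\<close> is 1 or 2.\<close>

type_synonym state = "real \<times> real"

definition Omega :: "state set" where
  "Omega = {(\<rho>, q). \<rho> > 0}"

definition vel :: "state \<Rightarrow> real" where
  "vel u = snd u / fst u"

definition lam :: "real \<Rightarrow> nat \<Rightarrow> state \<Rightarrow> real" where
  "lam a i u = vel u + (-1) ^ i * a"

definition shock_curve :: "real \<Rightarrow> nat \<Rightarrow> state \<Rightarrow> real \<Rightarrow> real" where
  "shock_curve a i uo \<rho> =
     \<rho> * (vel uo + (-1) ^ i * a * (sqrt (\<rho> / fst uo) - sqrt (fst uo / \<rho>)))"

definition rarefaction_curve :: "real \<Rightarrow> nat \<Rightarrow> state \<Rightarrow> real \<Rightarrow> real" where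
  "rarefaction_curve a i uo \<rho> = \<rho> * (vel uo + (-1) ^ i * a * ln (\<rho> / fst uo))"

text \<open>For \<open>i = 1\<close> this is the forward 1-Lax curve through \<open>uo\<close>, for \<open>i = 2\<close> the backward 2-Lax
  curve; both are graphs over all positive densities.\<close>

definition lax_curve :: "real \<Rightarrow> nat \<Rightarrow> state \<Rightarrow> state set" where
  "lax_curve a i uo = {(\<rho>, q). \<rho> > 0 \<and>
     q = (if \<rho> \<le> fst uo then rarefaction_curve a i uo \<rho> else shock_curve a i uo \<rho>)}"

abbreviation FL1 :: "real \<Rightarrow> state \<Rightarrow> state set" where
  "FL1 a uo \<equiv> lax_curve a 1 uo"

abbreviation BL2 :: "real \<Rightarrow> state \<Rightarrow> state set" where
  "BL2 a uo \<equiv> lax_curve a 2 uo"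

definition u_bar :: "real \<Rightarrow> state \<Rightarrow> state" where
  "u_bar a ul = (THE u. u \<in> FL1 a ul \<and> (\<forall>w\<in>FL1 a ul. snd w \<le> snd u))"

definition u_tilde :: "real \<Rightarrow> state \<Rightarrow> state \<Rightarrow> state" where
  "u_tilde a ul ur = (THE u. u \<in> FL1 a ul \<inter> BL2 a ur)"

definition u_hat :: "real \<Rightarrow> real \<Rightarrow> state \<Rightarrow> state" where
  "u_hat a qo ul = (THE u. u \<in> FL1 a ul \<and> snd u = qo \<and>
     (\<forall>w\<in>FL1 a ul. snd w = qo \<longrightarrow> fst w \<le> fst u))"

definition u_check :: "real \<Rightarrow> real \<Rightarrow> state \<Rightarrow> state" where
  "u_check a qo ur = (THE u. u \<in> BL2 a ur \<and> snd u = qo \<and>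
     (\<forall>w\<in>BL2 a ur. snd w = qo \<longrightarrow> fst w \<le> fst u))"

text \<open>In \<open>RS_p\<close>, the i-wave occupies the speeds from \<open>si_min\<close> to \<open>si_max\<close>; the two coincide when
  the wave is a shock or is absent. Strict comparisons make the solution right-continuous.\<close>

definition RS_p :: "real \<Rightarrow> state \<Rightarrow> state \<Rightarrow> real \<Rightarrow> state" where
  "RS_p a ul ur \<xi> =
    (let um = u_tilde a ul ur;
         shock1 = vel ul - a * sqrt (fst um / fst ul);
         shock2 = vel ur + a * sqrt (fst um / fst ur);
         s1_min = (if fst um > fst ul then shock1 else lam a 1 ul);
         s1_max = (if fst um > fst ul then shock1 else lam a 1 um);
         s2_min = (if fst um > fst ur then shock2 else lam a 2 um);
         s2_max = (if fst um > fst ur then shock2 else lam a 2 ur)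
     in if \<xi> < s1_min then ul
        else if \<xi> < s1_max then (THE u. u \<in> FL1 a ul \<and> lam a 1 u = \<xi>)
        else if \<xi> < s2_min then um
        else if \<xi> < s2_max then (THE u. u \<in> BL2 a ur \<and> lam a 2 u = \<xi>)
        else ur)"

definition Q_bar :: "real \<Rightarrow> state \<Rightarrow> real" where
  "Q_bar a u = (if vel u \<le> a then snd (u_bar a u) else snd u)"

definition RS_c :: "real \<Rightarrow> (state \<Rightarrow> state \<Rightarrow> real) \<Rightarrow> state \<Rightarrow> state \<Rightarrow> real \<Rightarrow> state" where
  "RS_c a Q ul ur \<xi> =
     (if \<xi> < 0 then RS_p a ul (u_hat a (Q ul ur) ul) \<xi>
      else RS_p a (u_check a (Q ul ur) ur) ur \<xi>)"

definition u_star0 :: "real \<Rightarrow> real \<Rightarrow> state" where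
  "u_star0 a qs = (exp 1 * qs / a, 0)"

definition u_sup :: "real \<Rightarrow> real \<Rightarrow> state" where
  "u_sup a qs = (THE u. 0 < fst u \<and> fst u < exp 1 * qs / a \<and>
     snd u = shock_curve a 1 (u_star0 a qs) (fst u) \<and> snd u = qs \<and> \<bar>vel u\<bar> > a)"

definition v_sup :: "real \<Rightarrow> real \<Rightarrow> real" where
  "v_sup a qs = vel (u_sup a qs)"

definition CHl_compl :: "real \<Rightarrow> real \<Rightarrow> state set" where
  "CHl_compl a qs = {u \<in> Omega. vel u > v_sup a qs \<and>
     shock_curve a 1 (u_star0 a qs) (fst u) \<le> snd u \<and> snd u < qs}"

definition CHl :: "real \<Rightarrow> real \<Rightarrow> state set" where
  "CHl a qs = Omega - CHl_compl a qs"

text \<open>The choice \<open>qs = 1\<close> is immaterial, by lemma \<open>v_sup_indep\<close> below.\<close>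

definition CHl1 :: "real \<Rightarrow> state set" where
  "CHl1 a = {u \<in> Omega. vel u \<le> v_sup a 1}"

definition Q_h :: "real \<Rightarrow> real \<Rightarrow> state \<Rightarrow> real" where
  "Q_h a qs ul = (if Q_bar a ul \<ge> qs then qs else if ul \<in> CHl a qs then 0 else snd ul)"

definition RS_h :: "real \<Rightarrow> real \<Rightarrow> state \<Rightarrow> state \<Rightarrow> real \<Rightarrow> state" where
  "RS_h a qs = RS_c a (\<lambda>ul ur. Q_h a qs ul)"

text \<open>The solution, for t > 0, with datum \<open>ul\<close> on x < 0 and \<open>ur\<close> on x >= 0. This is the datum
  (\<open>ui\<close> on x < -1, \<open>ul\<close> on -1 <= x < 0, \<open>ur\<close> on x >= 0) in the case \<open>ui = ul\<close>.\<close>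

definition sol :: "real \<Rightarrow> real \<Rightarrow> state \<Rightarrow> state \<Rightarrow> real \<Rightarrow> real \<Rightarrow> state" where
  "sol a qs ul ur t x = RS_h a qs ul ur (x / t)"

definition avg_flow :: "real \<Rightarrow> state \<Rightarrow> state \<Rightarrow> real \<Rightarrow> real \<Rightarrow> real" where
  "avg_flow a ul ur T qs = (1 / T) * integral {0..T} (\<lambda>t. snd (sol a qs ul ur t 0))"

lemma sup_root_ex1:
  "\<exists>!s::real. 0 < s \<and> s < 1 \<and> exp 1 * (s - s ^ 3) = 1 \<and> 1 - s\<^sup>2 > s"
proof -
  have "41/32 \<le> exp (1/4::real)"
    using exp_lower_Taylor_quadratic[of "1/4::real"] by (simp add: power2_eq_square)
  hence "(41/32) ^ 4 \<le> exp (1/4::real) ^ 4" by (intro power_mono) auto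
  hence e: "exp (1::real) > 8/3"
    by (simp add: exp_of_nat_mult[symmetric] field_simps)
  have small: "s < 1/2"
    if s: "0 < s" "exp 1 * (s - s ^ 3) = 1" "1 - s\<^sup>2 > s" for s :: real
  proof (rule ccontr)
    assume "\<not> s < 1/2"
    hence h: "s \<ge> 1/2" by simp
    have "s - s ^ 3 - 3/8 = (s - 1/2) * (3/4 - s / 2 - s\<^sup>2)"
      by (simp add: power2_eq_square power3_eq_cube field_simps)
    moreover have "3/4 - s / 2 - s\<^sup>2 \<ge> 0" using s(3) h by simp
    ultimately have "s - s ^ 3 \<ge> 3/8"
      using h by (smt (verit) mult_nonneg_nonneg)
    hence "exp 1 * (s - s ^ 3) \<ge> exp 1 * (3/8)" by simp
    thus False using e s(2) by simp
  qed
  have "\<exists>s::real. 0 \<le> s \<and> s \<le> 1/2 \<and> exp 1 * (s - s ^ 3) = 1"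
    using e by (intro IVT') (auto intro!: continuous_intros simp: power3_eq_cube)
  then obtain s :: real where s: "0 \<le> s" "s \<le> 1/2" "exp 1 * (s - s ^ 3) = 1" by blast
  have "s \<noteq> 0" using s(3) by auto
  moreover have "s\<^sup>2 \<le> (1/2)\<^sup>2" using s by (intro power_mono) auto
  ultimately have ex: "0 < s \<and> s < 1 \<and> exp 1 * (s - s ^ 3) = 1 \<and> 1 - s\<^sup>2 > s"
    using s by (simp add: power2_eq_square)
  show ?thesis
  proof (rule ex1I[of _ s])
    show "0 < s \<and> s < 1 \<and> exp 1 * (s - s ^ 3) = 1 \<and> 1 - s\<^sup>2 > s" by (rule ex)
  next
    fix t :: real
    assume t: "0 < t \<and> t < 1 \<and> exp 1 * (t - t ^ 3) = 1 \<and> 1 - t\<^sup>2 > t"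
    have lt: "t < 1/2" "s < 1/2" using small t ex by auto
    have "exp 1 * (t - t ^ 3) = exp 1 * (s - s ^ 3)" using t ex by simp
    hence "t - t ^ 3 = s - s ^ 3" by simp
    hence "(t - s) * (1 - t * t - t * s - s * s) = 0"
      by (simp add: power3_eq_cube algebra_simps)
    moreover have "t * t < 1/2 * (1/2)" "t * s < 1/2 * (1/2)" "s * s < 1/2 * (1/2)"
      using lt t ex by (intro mult_strict_mono; simp)+
    hence "1 - t * t - t * s - s * s \<noteq> 0" by simp
    ultimately show "t = s" by simp
  qed
qed

lemma u_sup_char:
  fixes a qs :: real and u :: state
  assumes "a > 0" "qs > 0"
  shows "(0 < fst u \<and> fst u < exp 1 * qs / a \<and>
      snd u = shock_curve a 1 (u_star0 a qs) (fst u) \<and> snd u = qs \<and> \<bar>vel u\<bar> > a) \<longleftrightarrow>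
    (\<exists>s. (0 < s \<and> s < 1 \<and> exp 1 * (s - s ^ 3) = 1 \<and> 1 - s\<^sup>2 > s) \<and>
      u = (exp 1 * qs / a * s\<^sup>2, qs))"
proof -
  define k where "k = exp 1 * qs / a"
  have k: "k > 0" using assms by (simp add: k_def)
  have ak: "a * k = exp 1 * qs" using assms by (simp add: k_def)
  have shock: "shock_curve a 1 (u_star0 a qs) (k * s\<^sup>2) = qs * (exp 1 * (s - s ^ 3))"
    if "0 < s" for s
  proof -
    have sq: "sqrt (k * s\<^sup>2 / k) = s" "sqrt (k / (k * s\<^sup>2)) = 1 / s"
      using that k by (auto simp: real_sqrt_divide)
    have "shock_curve a 1 (u_star0 a qs) (k * s\<^sup>2) = a * k * (s\<^sup>2 * (1 / s - s))"
      unfolding shock_curve_def u_star0_def vel_def fst_conv snd_conv k_def[symmetric] sq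
      by (simp add: algebra_simps)
    also have "s\<^sup>2 * (1 / s - s) = s - s ^ 3"
      using that by (simp add: field_simps power2_eq_square power3_eq_cube)
    finally show ?thesis by (simp add: ak)
  qed
  have speed: "\<bar>vel (k * s\<^sup>2, qs)\<bar> > a \<longleftrightarrow> 1 - s\<^sup>2 > s"
    if "0 < s" "exp 1 * (s - s ^ 3) = 1" for s
  proof -
    have "qs = a * k * (s - s ^ 3)" using ak that(2) by (simp add: mult.commute)
    also have "\<dots> = k * s\<^sup>2 * (a * (1 - s\<^sup>2) / s)"
      using that by (simp add: field_simps power2_eq_square power3_eq_cube)
    finally have "vel (k * s\<^sup>2, qs) = a * (1 - s\<^sup>2) / s"
      using k that by (simp add: vel_def)
    moreover have "vel (k * s\<^sup>2, qs) > 0" using k assms that by (simp add: vel_def)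
    moreover have "a * (1 - s\<^sup>2) / s > a \<longleftrightarrow> 1 - s\<^sup>2 > s"
      using that assms by (simp add: less_divide_eq)
    ultimately show ?thesis by linarith
  qed
  show ?thesis
  proof
    assume u: "0 < fst u \<and> fst u < exp 1 * qs / a \<and>
      snd u = shock_curve a 1 (u_star0 a qs) (fst u) \<and> snd u = qs \<and> \<bar>vel u\<bar> > a"
    define s where "s = sqrt (fst u / k)"
    have s: "0 < s" "s < 1" using u k by (auto simp: s_def k_def[symmetric])
    have "fst u = k * s\<^sup>2" using u k by (simp add: s_def)
    hence ueq: "u = (k * s\<^sup>2, qs)" using u by (simp add: prod_eq_iff)
    have root: "exp 1 * (s - s ^ 3) = 1" using u shock[OF s(1)] assms ueq by simp
    have "1 - s\<^sup>2 > s" using speed[OF s(1) root] u by (simp only: ueq)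
    thus "\<exists>s. (0 < s \<and> s < 1 \<and> exp 1 * (s - s ^ 3) = 1 \<and> 1 - s\<^sup>2 > s) \<and>
      u = (exp 1 * qs / a * s\<^sup>2, qs)"
      using s root ueq[unfolded k_def] by (intro exI[of _ s] conjI)
  next
    assume "\<exists>s. (0 < s \<and> s < 1 \<and> exp 1 * (s - s ^ 3) = 1 \<and> 1 - s\<^sup>2 > s) \<and>
      u = (exp 1 * qs / a * s\<^sup>2, qs)"
    then obtain s where s: "0 < s" "s < 1" "exp 1 * (s - s ^ 3) = 1" "1 - s\<^sup>2 > s"
      and u: "u = (k * s\<^sup>2, qs)" by (auto simp: k_def)
    have "s\<^sup>2 < 1" using s by (simp add: power_less_one_iff)
    hence "0 < fst u" "fst u < k" using k s u by auto
    moreover have "qs = shock_curve a 1 (u_star0 a qs) (fst u)"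
      using shock[OF s(1)] s(3) u by simp
    moreover have "\<bar>vel u\<bar> > a" using speed[OF s(1,3)] s(4) u by simp
    ultimately show "0 < fst u \<and> fst u < exp 1 * qs / a \<and>
      snd u = shock_curve a 1 (u_star0 a qs) (fst u) \<and> snd u = qs \<and> \<bar>vel u\<bar> > a"
      using u by (simp add: k_def[symmetric])
  qed
qed

lemma u_sup_eq:
  fixes a qs s :: real
  assumes "a > 0" "qs > 0"
    and s: "0 < s \<and> s < 1 \<and> exp 1 * (s - s ^ 3) = 1 \<and> 1 - s\<^sup>2 > s"
  shows "u_sup a qs = (exp 1 * qs / a * s\<^sup>2, qs)"
  unfolding u_sup_def u_sup_char[OF assms(1,2)]
proof (rule the_equality)
  show "\<exists>s'. (0 < s' \<and> s' < 1 \<and> exp 1 * (s' - s' ^ 3) = 1 \<and> 1 - s'\<^sup>2 > s') \<and>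
      (exp 1 * qs / a * s\<^sup>2, qs) = (exp 1 * qs / a * s'\<^sup>2, qs)"
    using s by (intro exI[of _ s] conjI) simp_all
next
  fix u assume "\<exists>s. (0 < s \<and> s < 1 \<and> exp 1 * (s - s ^ 3) = 1 \<and> 1 - s\<^sup>2 > s) \<and>
      u = (exp 1 * qs / a * s\<^sup>2, qs)"
  then obtain t where t: "0 < t \<and> t < 1 \<and> exp 1 * (t - t ^ 3) = 1 \<and> 1 - t\<^sup>2 > t"
    and u: "u = (exp 1 * qs / a * t\<^sup>2, qs)" by (elim exE conjE) simp
  have "t = s" using the1_equality[OF sup_root_ex1 s] the1_equality[OF sup_root_ex1 t] by simp
  thus "u = (exp 1 * qs / a * s\<^sup>2, qs)" using u by simp
qed

lemma v_sup_indep: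
  assumes "a > 0" "qs > 0"
  shows "v_sup a qs = v_sup a 1"
proof -
  obtain s :: real
    where s: "0 < s \<and> s < 1 \<and> exp 1 * (s - s ^ 3) = 1 \<and> 1 - s\<^sup>2 > s"
    using sup_root_ex1 by blast
  show ?thesis
    using assms by (simp add: v_sup_def vel_def u_sup_eq[OF _ _ s])
qed

end

theory Submission
  imports Defs
begin

text \<open>The origin lies in the constant state next to the junction, because the 2-wave on its right
  has positive speed. Hence the average flow does not depend on time and equals \<open>Q_h a qs ul\<close>,
  which is \<open>qs\<close> for \<open>qs \<le> Q_bar a ul\<close> and otherwise is 0 or, on \<open>CHl_compl a qs\<close>,
  \<open>snd ul = Q_bar a ul\<close>. So uniqueness fails exactly when \<open>ul \<in> CHl_compl a qs\<close> for some
  \<open>qs > Q_bar a ul\<close>. When \<open>vel ul > v_sup a 1\<close>, such a \<open>qs\<close> is obtained by letting the shock curve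
  through \<open>u_star0 a qs\<close> pass through \<open>ul\<close>.\<close>

section \<open>Lax curves\<close>

text \<open>The velocity along both Lax curves, measured from the base state in units of
  \<open>(-1) ^ i * a\<close>, as a function of the density ratio. One profile serves both families,
  and working with velocity instead of flow makes it monotone.\<close>

definition lax_profile :: "real \<Rightarrow> real" where
  "lax_profile r = (if r \<le> 1 then ln r else sqrt r - sqrt (1 / r))"

lemma mem_lax_curve_iff:
  assumes "fst uo > 0"
  shows "u \<in> lax_curve a i uo \<longleftrightarrow>
    fst u > 0 \<and> vel u = vel uo + (-1) ^ i * a * lax_profile (fst u / fst uo)"
  using assms
  by (cases u) (auto simp: lax_curve_def rarefaction_curve_def shock_curve_def vel_def
      lax_profile_def divide_simps mult.commute)

text \<open>Each branch is strictly increasing; across the branches the comparison goes through 0,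
  since the logarithm is nonpositive up to 1 and the shock branch is positive beyond 1.\<close>

lemma lax_profile_strict_mono:
  assumes "0 < r" "r < r'"
  shows "lax_profile r < lax_profile r'"
proof -
  have pos: "lax_profile x > 0" if "x > 1" for x
  proof -
    have "1 / x < x" using that by (simp add: field_simps less_1_mult)
    then show ?thesis using that by (simp add: lax_profile_def)
  qed
  show ?thesis
  proof (cases "r' \<le> 1")
    case True
    then show ?thesis using assms by (simp add: lax_profile_def)
  next
    case False
    show ?thesis
    proof (cases "r \<le> 1")
      case True
      then have "lax_profile r \<le> 0" using assms by (simp add: lax_profile_def)
      then show ?thesis using pos[of r'] False by simp
    next
      case r: False
      have "sqrt r < sqrt r'" using assms by simp
      moreover have "1 / r' < 1 / r" using assms by (simp add: field_simps)
      then have "sqrt (1 / r') < sqrt (1 / r)" by (rule real_sqrt_less_mono)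
      ultimately have "sqrt r - sqrt (1 / r) < sqrt r' - sqrt (1 / r')" by linarith
      then show ?thesis using False r by (simp add: lax_profile_def)
    qed
  qed
qed

lemma continuous_on_lax_profile: "continuous_on {0<..} lax_profile"
  unfolding lax_profile_def
  by (rule continuous_on_cases_1) (auto intro!: continuous_intros)

lemma vel_lax_curve_1_decreasing:
  assumes "a > 0" "fst uo > 0" "u \<in> FL1 a uo" "w \<in> FL1 a uo" "fst u < fst w"
  shows "vel w < vel u"
proof -
  have "lax_profile (fst u / fst uo) < lax_profile (fst w / fst uo)"
    using assms
    by (intro lax_profile_strict_mono) (auto simp: mem_lax_curve_iff divide_strict_right_mono)
  then show ?thesis using assms by (simp add: mem_lax_curve_iff)
qed

lemma vel_lax_curve_2_increasing:
  assumes "a > 0" "fst uo > 0" "u \<in> BL2 a uo" "w \<in> BL2 a uo" "fst u < fst w"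
  shows "vel u < vel w"
proof -
  have "lax_profile (fst u / fst uo) < lax_profile (fst w / fst uo)"
    using assms
    by (intro lax_profile_strict_mono) (auto simp: mem_lax_curve_iff divide_strict_right_mono)
  then show ?thesis using assms by (simp add: mem_lax_curve_iff)
qed

text \<open>Velocity decreases with density on \<open>FL1\<close> and increases on
  \<open>BL2\<close>, so two common points must have equal density. Hence exhibiting any common
  point determines the middle state.\<close>

lemma u_tilde_eqI:
  assumes "a > 0" "fst ul > 0" "fst ur > 0" "u \<in> FL1 a ul" "u \<in> BL2 a ur"
  shows "u_tilde a ul ur = u"
  unfolding u_tilde_def
proof (rule the_equality)
  fix w assume w: "w \<in> FL1 a ul \<inter> BL2 a ur"
  have "fst w = fst u"
    using vel_lax_curve_1_decreasing[of a ul u w] vel_lax_curve_1_decreasing[of a ul w u]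
      vel_lax_curve_2_increasing[of a ur u w] vel_lax_curve_2_increasing[of a ur w u] assms w
    by (metis IntD1 IntD2 less_asym linorder_neqE_linordered_idom)
  then show "w = u" using assms w by (auto simp: lax_curve_def)
qed (use assms in auto)

text \<open>At a fixed nonnegative flow q the velocity q / \<rho> cannot grow with the density,
  whereas along \<open>BL2\<close> it strictly grows.\<close>

lemma BL2_flow_inj:
  assumes "a > 0" "fst uo > 0" "u \<in> BL2 a uo" "w \<in> BL2 a uo" "snd u = snd w" "snd u \<ge> 0"
  shows "u = w"
proof -
  have False
    if "u \<in> BL2 a uo" "w \<in> BL2 a uo" "snd u = snd w" "snd u \<ge> 0" "fst u < fst w" for u w
  proof -
    have "vel u < vel w" using vel_lax_curve_2_increasing assms(1,2) that by blast
    moreover have "snd w / fst w \<le> snd w / fst u"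
      using that by (intro divide_left_mono) (auto simp: lax_curve_def)
    ultimately show False using that by (simp add: vel_def)
  qed
  then have "fst u = fst w" using assms by (metis linorder_neqE_linordered_idom)
  then show ?thesis using assms by (simp add: prod_eq_iff)
qed

lemma BL2_flow_surj:
  assumes a: "a > 0" and uo: "fst uo > 0" and q: "q \<ge> 0"
  shows "\<exists>u \<in> BL2 a uo. snd u = q"
proof -
  define f where "f = (\<lambda>r. fst uo * r * (vel uo + a * lax_profile r))"
  \<comment> \<open>Bracket for the intermediate value theorem applied to \<open>f\<close>, the flow
    at density \<open>fst uo * r\<close>. On the logarithmic branch, \<open>r1\<close> makes the
    velocity at most 0. The profile at \<open>r2\<close> is \<open>(1 + b) - 1 / (1 + b)\<close>,
    hence at least \<open>b\<close>, which makes the velocity at least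
    \<open>q / fst uo\<close>.\<close>
  define r1 where "r1 = exp (- \<bar>vel uo\<bar> / a)"
  define b where "b = (\<bar>vel uo\<bar> + q / fst uo) / a"
  define r2 where "r2 = (1 + b)\<^sup>2"
  have b: "b \<ge> 0" using a uo q by (simp add: b_def)
  have r1: "0 < r1" "r1 \<le> 1" using a by (simp_all add: r1_def)
  have r2: "1 \<le> r2" using b by (simp add: r2_def)
  have "lax_profile r1 = - \<bar>vel uo\<bar> / a" using r1 by (simp add: lax_profile_def) (simp add: r1_def)
  then have "vel uo + a * lax_profile r1 \<le> 0" using a by simp
  then have f1: "f r1 \<le> q"
    using r1 uo q by (auto simp: f_def intro!: order_trans[OF mult_nonneg_nonpos])
  have "lax_profile r2 \<ge> b"
  proof (cases "b = 0")
    case False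
    then have "r2 > 1" using b by (simp add: r2_def)
    then show ?thesis using b by (simp add: lax_profile_def r2_def real_sqrt_divide)
  qed (simp add: r2_def lax_profile_def)
  then have "a * lax_profile r2 \<ge> \<bar>vel uo\<bar> + q / fst uo"
    using a by (simp add: b_def field_simps)
  then have "vel uo + a * lax_profile r2 \<ge> q / fst uo" by linarith
  then have "fst uo * r2 * (vel uo + a * lax_profile r2) \<ge> fst uo * 1 * (q / fst uo)"
    using r2 uo q by (intro mult_mono) auto
  then have f2: "q \<le> f r2" using uo by (simp add: f_def)
  have "continuous_on {r1..r2} lax_profile"
    by (rule continuous_on_subset[OF continuous_on_lax_profile]) (use r1 in auto)
  then have "continuous_on {r1..r2} f" unfolding f_def by (intro continuous_intros)
  then obtain r where r: "r1 \<le> r" "f r = q"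
    using IVT'[of f r1 q r2] f1 f2 r1 r2 by auto
  have "(fst uo * r, q) \<in> BL2 a uo"
    using r r1 uo by (simp add: mem_lax_curve_iff) (auto simp: vel_def f_def)
  then show ?thesis by force
qed

text \<open>The intersection with the line is a single point, so the largest-density condition in
  \<open>u_check\<close> holds automatically.\<close>

lemma u_check_on_curve:
  assumes "a > 0" "fst ur > 0" "q \<ge> 0"
  shows "u_check a q ur \<in> BL2 a ur" "snd (u_check a q ur) = q"
proof -
  obtain u where u: "u \<in> BL2 a ur" "snd u = q" using BL2_flow_surj assms by blast
  have uniq: "w = u" if "w \<in> BL2 a ur" "snd w = q" for w
    using BL2_flow_inj[of a ur w u] that u assms by simp
  have "u_check a q ur = u"
    unfolding u_check_def
  proof (rule the_equality)
    show "u \<in> BL2 a ur \<and> snd u = q \<and> (\<forall>w\<in>BL2 a ur. snd w = q \<longrightarrow> fst w \<le> fst u)"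
      using u uniq by blast
  qed (use uniq in blast)
  then show "u_check a q ur \<in> BL2 a ur" "snd (u_check a q ur) = q" using u by auto
qed

lemma mem_lax_curve_self: "fst u > 0 \<Longrightarrow> u \<in> lax_curve a i u"
  by (simp add: mem_lax_curve_iff lax_profile_def)

section \<open>The flow through the junction\<close>

text \<open>The middle state is \<open>u\<close> itself, so there is no 1-wave, and the 2-wave
  begins at a positive speed.\<close>

lemma RS_p_at_0_of_BL2:
  assumes a: "a > 0" and ur: "fst ur > 0" and u: "u \<in> BL2 a ur" "snd u \<ge> 0"
  shows "RS_p a u ur 0 = u"
proof -
  have fu: "fst u > 0" using u by (auto simp: lax_curve_def)
  have ut: "u_tilde a u ur = u"
    using u_tilde_eqI[OF a fu ur mem_lax_curve_self[OF fu] u(1)] .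
  have v: "vel u \<ge> 0" using fu u by (simp add: vel_def)
  \<comment> \<open>On the shock branch the speed of the 2-shock equals
    \<open>vel u + a * sqrt (fst ur / fst u)\<close>. In the rarefaction case the leading speed is
    \<open>vel u + a\<close>.\<close>
  have "vel ur + a * sqrt (fst u / fst ur) > 0" if "fst u > fst ur"
  proof -
    have "vel u = vel ur + a * (sqrt (fst u / fst ur) - sqrt (fst ur / fst u))"
      using u that ur by (simp add: mem_lax_curve_iff lax_profile_def)
    moreover have "a * sqrt (fst ur / fst u) > 0" using a ur fu by simp
    ultimately show ?thesis using v by (simp add: algebra_simps)
  qed
  then show ?thesis using a v unfolding RS_p_def Let_def ut by (simp add: lam_def)
qed

text \<open>The integrand is constant: \<open>0 / t = 0\<close> for all \<open>t\<close>, including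
  \<open>t = 0\<close>, and at speed 0 the solver takes the right trace \<open>u_check\<close>,
  whose flow is \<open>Q_h a qs ul\<close>.\<close>

lemma avg_flow_eq_Q_h:
  assumes "a > 0" "fst ur > 0" "T > 0" "Q_h a qs ul \<ge> 0"
  shows "avg_flow a ul ur T qs = Q_h a qs ul"
  using assms u_check_on_curve[of a ur "Q_h a qs ul"]
  by (simp add: avg_flow_def sol_def RS_h_def RS_c_def RS_p_at_0_of_BL2)

text \<open>With w = v/a and density ratio r, the flow is a multiple of
  \<open>r * (w - lax_profile r)\<close>. Its maximum lies on the rarefaction branch, at the sonic
  point r = exp (w - 1).\<close>

lemma u_bar_subsonic:
  assumes a: "a > 0" and uo: "fst uo > 0" and sub: "vel uo \<le> a"
  shows "u_bar a uo = (fst uo * exp (vel uo / a - 1), a * fst uo * exp (vel uo / a - 1))"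
proof -
  define w where "w = vel uo / a"
  define E where "E = exp (w - 1)"
  have w: "w \<le> 1" "vel uo = a * w" using a sub by (auto simp: w_def)
  have E: "0 < E" "E \<le> 1" "w \<le> E" using w exp_ge_add_one_self[of "w - 1"] by (auto simp: E_def)
  have flow: "snd u = a * fst uo * (r * (w - lax_profile r))"
    if "u \<in> FL1 a uo" "r = fst u / fst uo" for u r
  proof -
    have "snd u = fst u * vel u" using that by (auto simp: vel_def lax_curve_def)
    moreover have "fst u = fst uo * r" using that uo by simp
    moreover have "vel u = a * (w - lax_profile r)"
      using that uo w(2) by (simp add: mem_lax_curve_iff right_diff_distrib)
    ultimately show ?thesis by (simp only: mult_ac)
  qed
  have strict: "r * (w - lax_profile r) < E" if "r > 0" "r \<noteq> E" for r
  proof (cases "r \<le> 1")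
    case True
    \<comment> \<open>The inequality ln x \<le> x - 1, strict for x \<noteq> 1, is applied at x =
      E/r, where ln E = w - 1.\<close>
    have "ln (E / r) \<noteq> E / r - 1" using ln_eq_minus_one[of "E / r"] that E by auto
    moreover have "ln (E / r) \<le> E / r - 1" using that E by (intro ln_le_minus_one) auto
    ultimately have "w - ln r < E / r"
      using that E by (simp add: ln_div) (simp add: E_def)
    then have "r * (w - ln r) < r * (E / r)" using that by (intro mult_strict_left_mono)
    then show ?thesis using True that by (simp add: lax_profile_def)
  next
    case False
    define s where "s = sqrt r"
    have s: "s > 1" "r = s\<^sup>2" using False by (auto simp: s_def)
    \<comment> \<open>The factorization shows that beyond \<open>r = 1\<close> the flow stays below
      its value \<open>w\<close> at \<open>r = 1\<close>, which is at most \<open>E\<close>.\<close>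
    have "r * (w - lax_profile r) - w = (w - s) * (s\<^sup>2 - 1)"
      using False s by (simp add: lax_profile_def real_sqrt_divide field_simps power2_eq_square)
    moreover have "(w - s) * (s\<^sup>2 - 1) < 0" using s w by (intro mult_neg_pos) auto
    ultimately show ?thesis using E by linarith
  qed
  define m where "m = (fst uo * E, a * fst uo * E)"
  have m: "m \<in> FL1 a uo"
    using uo E a w(2) by (simp add: mem_lax_curve_iff m_def lax_profile_def vel_def[of "(_, _)"])
      (simp add: E_def algebra_simps)
  have less: "snd u < snd m" if "u \<in> FL1 a uo" "u \<noteq> m" for u
  proof -
    have "fst u \<noteq> fst m" using that m by (auto simp: lax_curve_def)
    then have "fst u / fst uo \<noteq> E" using uo by (auto simp: m_def)
    moreover have "fst u > 0" using that by (auto simp: lax_curve_def)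
    ultimately have "a * fst uo * (fst u / fst uo * (w - lax_profile (fst u / fst uo)))
        < a * fst uo * E"
      using uo a by (intro mult_strict_left_mono strict) auto
    then show ?thesis unfolding flow[OF that(1) refl] m_def by simp
  qed
  have "u_bar a uo = m"
    unfolding u_bar_def
  proof (rule the_equality)
    show "m \<in> FL1 a uo \<and> (\<forall>w\<in>FL1 a uo. snd w \<le> snd m)"
      using m less by (metis order.strict_implies_order order_refl)
  next
    fix u assume "u \<in> FL1 a uo \<and> (\<forall>w\<in>FL1 a uo. snd w \<le> snd u)"
    then show "u = m" using m less[of u] by force
  qed
  then show ?thesis by (simp add: m_def E_def w_def)
qed

lemma Q_bar_pos:
  assumes "a > 0" "fst u > 0"
  shows "Q_bar a u > 0"
proof (cases "vel u \<le> a")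
  case False
  then have "vel u > 0" using assms by simp
  then show ?thesis using assms False by (simp add: Q_bar_def vel_def zero_less_divide_iff)
qed (use assms in \<open>simp add: Q_bar_def u_bar_subsonic\<close>)

section \<open>The set of exceptional supersonic states\<close>

text \<open>Here \<open>s\<close> is the square root of the density ratio of \<open>u_sup\<close> to
  \<open>u_star0\<close>; the last formula is the velocity a (1/s - s) on the shock curve.\<close>

lemma v_sup_root:
  assumes "a > 0"
  obtains s where "0 < s" "s < 1" "exp 1 * (s - s ^ 3) = 1" "1 - s\<^sup>2 > s"
    "v_sup a 1 = a * (1 - s\<^sup>2) / s"
proof -
  obtain s :: real where s: "0 < s \<and> s < 1 \<and> exp 1 * (s - s ^ 3) = 1 \<and> 1 - s\<^sup>2 > s"
    using sup_root_ex1 by blast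
  have e: "1 / exp 1 = s - s ^ 3" using s by (simp add: field_simps)
  have "v_sup a 1 = a * (1 / exp 1) / s\<^sup>2"
    using assms by (simp add: v_sup_def u_sup_eq[OF _ _ s] vel_def field_simps)
  also have "\<dots> = a * (1 - s\<^sup>2) / s"
    unfolding e using s by (simp add: field_simps power2_eq_square power3_eq_cube)
  finally show ?thesis using that s by blast
qed

text \<open>Thus a state faster than \<open>v_sup\<close> is supersonic, and its maximal flow is its
  own flow.\<close>

lemma v_sup_gt:
  assumes "a > 0"
  shows "v_sup a 1 > a"
proof -
  obtain s where s: "0 < s" "1 - s\<^sup>2 > s" "v_sup a 1 = a * (1 - s\<^sup>2) / s"
    using v_sup_root[OF assms] by metis
  then show ?thesis using assms by (simp add: less_divide_eq)
qed

lemma CHl_complD: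
  assumes "a > 0" "qs > 0" "u \<in> CHl_compl a qs"
  shows "vel u > v_sup a 1" "Q_bar a u = snd u"
proof -
  show v: "vel u > v_sup a 1" using assms v_sup_indep[of a qs] by (simp add: CHl_compl_def)
  show "Q_bar a u = snd u" using v v_sup_gt[OF assms(1)] by (simp add: Q_bar_def)
qed

text \<open>On the shock curve through \<open>u_star0\<close> the velocity fixes the root
  \<open>s\<close> of the density ratio, and the flow is \<open>qs * exp 1 * (s - s ^ 3)\<close>. A
  velocity above \<open>v_sup\<close> forces \<open>s < s0\<close>, where the factor of
  \<open>qs\<close> is below 1.\<close>

lemma ex_CHl_compl:
  assumes a: "a > 0" and u: "fst u > 0" and v: "vel u > v_sup a 1"
  shows "\<exists>qs>snd u. u \<in> CHl_compl a qs"
proof -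
  obtain s0 where s0: "0 < s0" "s0 < 1" "exp 1 * (s0 - s0 ^ 3) = 1" "1 - s0\<^sup>2 > s0"
    "v_sup a 1 = a * (1 - s0\<^sup>2) / s0"
    using v_sup_root[OF a] by blast
  define w where "w = vel u / a"
  have w: "vel u = a * w" using a by (simp add: w_def)
  have "w > 0" using v v_sup_gt[OF a] a by (simp add: w_def)
  \<comment> \<open>The positive root of s^2 + w s = 1, that is, of w = 1/s - s.\<close>
  define s where "s = (sqrt (w\<^sup>2 + 4) - w) / 2"
  have "sqrt (w\<^sup>2) < sqrt (w\<^sup>2 + 4)" by (intro real_sqrt_less_mono) simp
  then have s: "s > 0" using \<open>w > 0\<close> by (simp add: s_def)
  have "2 * s = sqrt (w\<^sup>2 + 4) - w" by (simp add: s_def)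
  then have "2 * s + w = sqrt (w\<^sup>2 + 4)" by linarith
  then have "(2 * s + w)\<^sup>2 = w\<^sup>2 + 4" by simp
  then have ws: "w * s = 1 - s\<^sup>2" by (simp add: power2_eq_square algebra_simps)
  have "a * ((1 - s0\<^sup>2) / s0) < a * w" using v s0(5) w by simp
  then have "(1 - s0\<^sup>2) / s0 < w" using a mult_less_cancel_left_pos by blast
  then have w0: "1 - s0\<^sup>2 < w * s0" using s0 by (simp add: field_simps)
  have "s < s0"
  proof (rule ccontr)
    assume "\<not> s < s0"
    then have "w * s0 \<le> w * s" "s0\<^sup>2 \<le> s\<^sup>2" using \<open>w > 0\<close> s0 by (auto intro: power_mono)
    then show False using w0 ws by linarith
  qed
  \<comment> \<open>Otherwise \<open>s\<close> is beyond a smaller root of \<open>exp 1 * (s - s ^ 3) = 1\<close>, against the uniqueness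
    of \<open>s0\<close>.\<close>
  have small: "exp 1 * (s - s ^ 3) < 1"
  proof (rule ccontr)
    assume "\<not> exp 1 * (s - s ^ 3) < 1"
    then have "\<exists>t. 0 \<le> t \<and> t \<le> s \<and> exp 1 * (t - t ^ 3) = 1"
      using s by (intro IVT') (auto intro!: continuous_intros)
    then obtain t where t: "0 \<le> t" "t \<le> s" "exp 1 * (t - t ^ 3) = 1" by blast
    have "t \<noteq> 0" using t(3) by auto
    moreover have "t\<^sup>2 \<le> s0\<^sup>2" using t \<open>s < s0\<close> by (intro power_mono) auto
    then have "1 - t\<^sup>2 > t" using t s0(4) \<open>s < s0\<close> by linarith
    ultimately have "0 < t \<and> t < 1 \<and> exp 1 * (t - t ^ 3) = 1 \<and> 1 - t\<^sup>2 > t"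
      using t s0 \<open>s < s0\<close> by auto
    then have "t = s0" using sup_root_ex1 s0 by blast
    then show False using t \<open>s < s0\<close> by simp
  qed
  \<comment> \<open>Chosen so that \<open>u_star0\<close> has density
    \<open>fst u / s\<^sup>2\<close>, which puts \<open>u\<close> on its shock curve.\<close>
  define qs where "qs = a * fst u / (exp 1 * s\<^sup>2)"
  have k: "fst (u_star0 a qs) = fst u / s\<^sup>2" using a by (simp add: u_star0_def qs_def)
  have su: "snd u = fst u * (a * w)" using w u by (simp add: vel_def field_simps)
  have sq: "sqrt (fst u / (fst u / s\<^sup>2)) = s" "sqrt (fst u / s\<^sup>2 / fst u) = 1 / s"
    using u s by (simp_all add: real_sqrt_divide)
  have wdiv: "w = 1 / s - s" using ws s by (simp add: field_simps power2_eq_square)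
  have "shock_curve a 1 (u_star0 a qs) (fst u) = snd u"
    unfolding shock_curve_def k sq su wdiv by (simp add: u_star0_def vel_def algebra_simps)
  moreover have "snd u < qs"
  proof -
    have "exp 1 * (s - s ^ 3) = exp 1 * s * (w * s)"
      unfolding ws by (simp add: power2_eq_square power3_eq_cube algebra_simps)
    then have "w * (exp 1 * s\<^sup>2) < 1" using small by (simp add: power2_eq_square mult_ac)
    then have "(a * fst u) * (w * (exp 1 * s\<^sup>2)) < (a * fst u) * 1"
      using a u by (intro mult_strict_left_mono) auto
    then show ?thesis unfolding su qs_def using s by (simp add: field_simps)
  qed
  moreover have "qs > 0" using a u s by (simp add: qs_def)
  ultimately show ?thesis
    using u v v_sup_indep[OF a, of qs] by (auto simp: CHl_compl_def Omega_def intro!: exI[of _ qs])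
qed

section \<open>The maximizers of the average flow\<close>

theorem proposition5p1:
  fixes a T :: real and ul ur :: state
  assumes "a > 0" and "ul \<in> Omega" and "ur \<in> Omega" and "T > 0"
  shows "(Q_bar a ul \<in> avg_flow a ul ur T ` {0<..} \<and>
            (\<forall>m \<in> avg_flow a ul ur T ` {0<..}. m \<le> Q_bar a ul)) \<and>
         is_arg_max (avg_flow a ul ur T) (\<lambda>qs. qs > 0) (Q_bar a ul) \<and>
         ((\<exists>!qs. is_arg_max (avg_flow a ul ur T) (\<lambda>qs. qs > 0) qs) \<longleftrightarrow> ul \<in> CHl1 a)"
proof -
  let ?F = "avg_flow a ul ur T" and ?Q = "Q_bar a ul"
  have pos: "fst ul > 0" "fst ur > 0" using assms by (auto simp: Omega_def)
  have Q: "?Q > 0" using Q_bar_pos assms(1) pos by blast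
  have low: "?F qs = qs" if "0 < qs" "qs \<le> ?Q" for qs
    using that assms pos by (simp add: avg_flow_eq_Q_h Q_h_def)
  have high: "?F qs = (if ul \<in> CHl_compl a qs then ?Q else 0)" if "?Q < qs" for qs
  proof -
    have "Q_h a qs ul = (if ul \<in> CHl_compl a qs then ?Q else 0)"
      using that Q CHl_complD(2)[of a qs ul] assms by (auto simp: Q_h_def CHl_def)
    then show ?thesis using Q assms pos avg_flow_eq_Q_h[of a ur T qs ul] by auto
  qed
  have le: "?F qs \<le> ?Q" if "qs > 0" for qs
    using low[OF that] high[of qs] Q by (cases "qs \<le> ?Q") auto
  have arg_max_iff: "is_arg_max ?F (\<lambda>qs. qs > 0) qs \<longleftrightarrow> qs > 0 \<and> ?F qs = ?Q" for qs
  proof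
    assume "is_arg_max ?F (\<lambda>qs. qs > 0) qs"
    then have "qs > 0" "\<not> ?F qs < ?F ?Q" using Q by (auto simp: is_arg_max_def)
    then show "qs > 0 \<and> ?F qs = ?Q" using le[of qs] low[OF Q order_refl] by simp
  next
    assume "qs > 0 \<and> ?F qs = ?Q"
    then show "is_arg_max ?F (\<lambda>qs. qs > 0) qs" using le by (metis is_arg_max_def leD)
  qed
  have max_iff: "qs > 0 \<and> ?F qs = ?Q \<longleftrightarrow> qs = ?Q \<or> ?Q < qs \<and> ul \<in> CHl_compl a qs" for qs
    using low[of qs] high[of qs] Q by (cases "qs \<le> ?Q") auto
  \<comment> \<open>By \<open>max_iff\<close>, \<open>?Q\<close> is always a maximizer and every
    other one exceeds it, so the left-hand side is exactly the failure of uniqueness.\<close>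
  have "(\<exists>qs>?Q. ul \<in> CHl_compl a qs) \<longleftrightarrow> ul \<notin> CHl1 a"
  proof
    assume "\<exists>qs>?Q. ul \<in> CHl_compl a qs"
    then obtain qs where "qs > ?Q" "ul \<in> CHl_compl a qs" by blast
    then have "vel ul > v_sup a 1" using CHl_complD(1)[of a qs ul] assms(1) Q by auto
    then show "ul \<notin> CHl1 a" by (simp add: CHl1_def)
  next
    assume "ul \<notin> CHl1 a"
    then have v: "vel ul > v_sup a 1" using assms(2) by (simp add: CHl1_def)
    then have "?Q = snd ul" using v_sup_gt[OF assms(1)] by (simp add: Q_bar_def)
    then show "\<exists>qs>?Q. ul \<in> CHl_compl a qs" using ex_CHl_compl assms(1) pos(1) v by auto
  qed
  then have "(\<exists>!qs. is_arg_max ?F (\<lambda>qs. qs > 0) qs) \<longleftrightarrow> ul \<in> CHl1 a"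
    unfolding arg_max_iff max_iff by blast
  moreover have "?Q \<in> ?F ` {0<..}" using low[OF Q order_refl] Q by force
  moreover have "is_arg_max ?F (\<lambda>qs. qs > 0) ?Q" using arg_max_iff low[OF Q order_refl] Q by simp
  ultimately show ?thesis using le by (intro conjI ballI) auto
qed

end
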